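(* Assume that $\mathrm{cov}(\mathcal{N})=\mathfrak{b}=\mathfrak{c}$. Then there is a Hurewicz totally imperfect set $X$ (a subset of $2^\omega$ or of $2^\omega\times 2^\omega$) which does not satisfy $\mathsf{S}_1(\Gamma,\mathrm{O})$.
   Context: $2^\omega$ is the Cantor space. $\mathfrak{c}$ is the cardinality of the continuum; $\mathfrak{b}$ is the bounding number, i.e. the minimal cardinality of a subset of $\omega^\omega$ that is unbounded with respect to eventual domination $\le^*$; $\mathrm{cov}(\mathcal{N})$ is the minimal cardinality of a family of Lebesgue-null subsets of $2^\omega$ which covers $2^\omega$. A family $\{V_n: n\in\omega\}$ of sets is a $\gamma$-cover of $X$ if for every $x\in X$ the set $\{n\in\omega: x\in V_n\}$ is cofinite. A set $X$ is Hurewicz if for every sequence $\mathcal{U}_0,\mathcal{U}_1,\dots$ of open covers of $X$ there are finite sets $\mathcal{F}_0\subseteq\mathcal{U}_0,\mathcal{F}_1\subseteq\mathcal{U}_1,\dots$ such that $\{\bigcup\mathcal{F}_n: n\in\omega\}$ is a $\gamma$-cover of $X$. A set $X$ satisfies $\mathsf{S}_1(\Gamma,\mathrm{O})$ if for every sequence $\mathcal{U}_0,\mathcal{U}_1,\dots$ of open $\gamma$-covers of $X$ there are sets $U_0\in\mathcal{U}_0,U_1\in\mathcal{U}_1,\dots$ such that the family $\{U_n: n\in\omega\}$ covers $X$. A set is totally imperfect if it contains no perfect subset, i.e. no homeomorphic copy of $2^\omega$. *)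

theory Defs
  imports "HOL-Probability.Probability"
begin

unbundle cardinal_syntax

section \<open>Cardinal characteristics\<close>

text \<open>Cardinals are represented by cardinal orders and compared with \<open>\<le>o\<close> and \<open>=o\<close>.
  For a nonempty family \<open>\<A>\<close>, \<open>min_card \<A>\<close> is the least cardinality of a member of \<open>\<A>\<close>
  (lemma \<open>min_card\<close> below).\<close>

definition min_card :: "'a set set \<Rightarrow> 'a rel" where
  "min_card \<A> = (SOME r. r \<in> card_of ` \<A> \<and> (\<forall>A\<in>\<A>. r \<le>o |A| ))"

lemma min_card:
  assumes "\<A> \<noteq> {}"
  shows "min_card \<A> \<in> card_of ` \<A> \<and> (\<forall>A\<in>\<A>. min_card \<A> \<le>o |A| )"
proof -
  have "\<exists>r\<in>card_of ` \<A>. \<forall>r'\<in>card_of ` \<A>. r \<le>o r'"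
    using assms by (intro exists_minim_Card_order) (auto intro: card_of_Card_order)
  then have "\<exists>r. r \<in> card_of ` \<A> \<and> (\<forall>A\<in>\<A>. r \<le>o |A| )" by blast
  then show ?thesis unfolding min_card_def by (rule someI_ex)
qed

definition continuum :: "real rel" where
  "continuum = |UNIV :: real set|"

definition eventually_dominated :: "(nat \<Rightarrow> nat) \<Rightarrow> (nat \<Rightarrow> nat) \<Rightarrow> bool" (infix \<open>\<le>*\<close> 50) where
  "f \<le>* g \<longleftrightarrow> (\<forall>\<^sub>F n in sequentially. f n \<le> g n)"

definition bounding_number :: "(nat \<Rightarrow> nat) rel" where
  "bounding_number = min_card {B. \<not> (\<exists>g. \<forall>f\<in>B. f \<le>* g)}"

type_synonym cantor = "nat \<Rightarrow> bool"

text \<open>Lebesgue measure on the Cantor space is the fair coin-tossing measure. Lebesgue-null sets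
  are the null sets of its completion: they need not be Borel.\<close>

definition cantor_measure :: "cantor measure" where
  "cantor_measure = Pi\<^sub>M UNIV (\<lambda>_. measure_pmf (bernoulli_pmf (1 / 2)))"

definition cov_null :: "cantor set rel" where
  "cov_null = min_card {\<N>. \<N> \<subseteq> null_sets (completion cantor_measure) \<and> \<Union>\<N> = UNIV}"

section \<open>Covering properties\<close>

text \<open>Covers of a subset \<open>X\<close> of a space consist of sets open in the ambient space; tracing them
  on \<open>X\<close> gives the same notions as using relatively open sets.\<close>

definition open_covers :: "'a::topological_space set \<Rightarrow> 'a set set set" where
  "open_covers X = {\<U>. (\<forall>U\<in>\<U>. open U) \<and> X \<subseteq> \<Union>\<U>}"

text \<open>A gamma-cover is a sequence, possibly with repetitions, rather than a set of sets.\<close>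

definition gamma_cover :: "(nat \<Rightarrow> 'a set) \<Rightarrow> 'a set \<Rightarrow> bool" where
  "gamma_cover V X \<longleftrightarrow> (\<forall>x\<in>X. finite (- {n. x \<in> V n}))"

definition open_gamma_covers :: "'a::topological_space set \<Rightarrow> 'a set set set" where
  "open_gamma_covers X = {range V |V. (\<forall>n. open (V n)) \<and> gamma_cover V X}"

definition hurewicz :: "'a::topological_space set \<Rightarrow> bool" where
  "hurewicz X \<longleftrightarrow>
    (\<forall>\<U> :: nat \<Rightarrow> 'a set set. (\<forall>n. \<U> n \<in> open_covers X) \<longrightarrow>
      (\<exists>\<F>. (\<forall>n. finite (\<F> n) \<and> \<F> n \<subseteq> \<U> n) \<and> gamma_cover (\<lambda>n. \<Union>(\<F> n)) X))"

definition S1_Gamma_O :: "'a::topological_space set \<Rightarrow> bool" where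
  "S1_Gamma_O X \<longleftrightarrow>
    (\<forall>\<U> :: nat \<Rightarrow> 'a set set. (\<forall>n. \<U> n \<in> open_gamma_covers X) \<longrightarrow>
      (\<exists>U. (\<forall>n. U n \<in> \<U> n) \<and> X \<subseteq> (\<Union>n. U n)))"

definition totally_imperfect :: "'a::topological_space set \<Rightarrow> bool" where
  "totally_imperfect X \<longleftrightarrow> \<not> (\<exists>P\<subseteq>X. P homeomorphic (UNIV :: cantor set))"

end

theory Submission
  imports Defs
begin

text \<open>List the pairs \<open>(x, K)\<close> with \<open>K\<close> closed of positive measure, and the sequences of open sets of
  the square whose \<open>limsup\<close> of complements has null vertical sections; both lists have length
  continuum. By \<open>cov(N) = c\<close> and the zero-one law, fewer than continuum many null sets do not cover
  \<open>K\<close>, so one can choose points \<open>(x, y)\<close> with \<open>y \<in> K\<close> that avoid all earlier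
  \<open>limsup\<close> sets. The resulting set \<open>X\<close> meets each \<open>limsup\<close> set in fewer than continuum many points,
  while each of its vertical sections, and the complement of each section, meets every closed
  nonnull set.

  Hence open covers of \<open>X\<close> cover almost all of every vertical line. By compactness finitely many
  members of the \<open>n\<close>-th cover suffice up to measure \<open>2\<^sup>-\<^sup>n\<close>, uniformly in the line, and the Borel-Cantelli
  lemma leaves out fewer than continuum many points of \<open>X\<close>, which \<open>b = c\<close> takes care of. A
  compact subset of \<open>X\<close> has null vertical sections, so it is itself a \<open>limsup\<close> set and too small
  to be perfect. Finally \<open>X\<close> projects onto the Cantor space, which fails \<open>S\<^sub>1(\<Gamma>,O)\<close>.\<close>

section \<open>Cylinders in the Cantor space\<close>

text \<open>Second countability passes from \<open>bool\<close> to \<open>cantor\<close> and to its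
  square. The Borel sets of the product, the coding of open sets and the Lindelof property rest on
  it.\<close>

instance bool :: second_countable_topology
proof
  have "(open :: bool set \<Rightarrow> bool) = generate_topology (UNIV :: bool set set)"
    by (auto simp: fun_eq_iff Topological_Spaces.open_discrete intro: generate_topology.Basis)
  then show "\<exists>B :: bool set set. countable B \<and> open = generate_topology B"
    by (intro exI[of _ UNIV]) (auto intro: countable_finite)
qed

definition cyl :: "nat \<Rightarrow> cantor \<Rightarrow> cantor set" where
  "cyl n s = {x. \<forall>i<n. x i = s i}"

lemma mem_cyl_self [simp]: "s \<in> cyl n s"
  by (simp add: cyl_def)

lemma open_cyl: "open (cyl n s)"
proof -
  have "open {x::cantor. \<forall>i\<in>{..<n}. x i \<in> {s i}}"
    by (rule product_topology_basis') (auto simp: Topological_Spaces.open_discrete)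
  then show ?thesis by (simp add: cyl_def lessThan_def)
qed

lemma open_contains_cyl:
  assumes "open U" "x \<in> U"
  shows "\<exists>n. cyl n x \<subseteq> U"
proof -
  from product_topology_open_contains_basis[OF assms(1)[unfolded open_fun_def] assms(2)]
  obtain X where X: "x \<in> Pi\<^sub>E UNIV X" "finite {i. X i \<noteq> topspace euclidean}" "Pi\<^sub>E UNIV X \<subseteq> U"
    by (elim exE conjE)
  from X(2) have "finite {i. X i \<noteq> UNIV}" by simp
  then obtain n where "{i. X i \<noteq> UNIV} \<subseteq> {..<n}"
    unfolding finite_nat_iff_bounded by (elim exE)
  then have n: "i < n" if "X i \<noteq> UNIV" for i
    using that by blast
  have "y \<in> Pi\<^sub>E UNIV X" if "y \<in> cyl n x" for y
  proof (rule PiE_I)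
    fix i show "y i \<in> X i"
    proof (cases "X i = UNIV")
      case False
      then have "y i = x i" using n[OF False] that by (simp add: cyl_def)
      then show ?thesis using X(1) by (simp add: PiE_iff)
    qed auto
  qed auto
  then show ?thesis using X(3) by blast
qed

lemma open_if_saturated:
  assumes "\<And>x. x \<in> D \<Longrightarrow> cyl n x \<subseteq> D"
  shows "open D"
proof -
  have "D = (\<Union>x\<in>D. cyl n x)" using assms mem_cyl_self by blast
  then show ?thesis by (metis open_UN open_cyl)
qed

text \<open>Lying in the same cylinder of length \<open>n\<close> is an equivalence relation, so the
  complement is saturated too, and saturated sets are clopen.\<close>

lemma closed_if_saturated:
  assumes "\<And>x. x \<in> D \<Longrightarrow> cyl n x \<subseteq> D"
  shows "closed D"
  unfolding closed_def
proof (rule open_if_saturated[where n=n], rule subsetI)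
  fix x y assume "x \<in> - D" "y \<in> cyl n x"
  then show "y \<in> - D" using assms[of y] by (auto simp: cyl_def)
qed

lemma compact_UNIV_cantor: "compact (UNIV :: cantor set)"
proof -
  have "compact_space (product_topology (\<lambda>i::nat. euclidean :: bool topology) UNIV)"
    by (subst compact_space_product_topology)
      (simp add: compact_space_def compactin_euclidean_iff finite_imp_compact)
  then show ?thesis
    by (simp add: euclidean_product_topology compact_space_def flip: compactin_euclidean_iff)
qed

lemma closed_imp_compact_cantor: "closed C \<Longrightarrow> compact (C :: cantor set)"
  using compact_Int_closed[OF compact_UNIV_cantor, of C] by simp

text \<open>The square is Hausdorff; this is derived for abstract product topologies and carried
  over by \<open>euclidean_product_topology\<close>. It is applied to copies of the Cantor space
  inside the square.\<close>

lemma closed_if_compact_cantor_prod: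
  assumes "compact (P :: (cantor \<times> cantor) set)"
  shows "closed P"
proof -
  have "Hausdorff_space (euclidean :: bool topology)"
    unfolding Hausdorff_space_def
    by (metis Topological_Spaces.open_discrete disjnt_insert1 disjnt_empty1 open_openin singletonD singletonI)
  then have "Hausdorff_space (product_topology (\<lambda>_::nat. euclidean :: bool topology) UNIV)"
    by (simp add: Hausdorff_space_product_topology)
  then have "Hausdorff_space (euclidean :: cantor topology)"
    by (simp only: euclidean_product_topology)
  then have "Hausdorff_space (prod_topology euclidean euclidean :: (cantor \<times> cantor) topology)"
    by (simp only: Hausdorff_space_prod_topology simp_thms)
  then show ?thesis
    using assms compactin_imp_closedin[of "euclidean :: (cantor \<times> cantor) topology" P] by simp
qed

section \<open>The coin-tossing measure\<close>

lemma prob_space_cantor: "prob_space cantor_measure"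
  unfolding cantor_measure_def by (rule prob_space_PiM) (rule measure_pmf.prob_space_axioms)

interpretation cm: prob_space cantor_measure
  by (rule prob_space_cantor)

lemma sets_cantor_measure [measurable_cong, simp]: "sets cantor_measure = sets borel"
proof -
  have "sets (borel :: bool measure) = UNIV"
    by (auto intro: borel_open Topological_Spaces.open_discrete)
  then have "sets cantor_measure = sets (Pi\<^sub>M UNIV (\<lambda>_::nat. borel :: bool measure))"
    unfolding cantor_measure_def by (intro sets_PiM_cong) auto
  then show ?thesis by (simp add: sets_PiM_equal_borel)
qed

lemma space_cantor_measure [simp]: "space cantor_measure = UNIV"
  using sets_eq_imp_space_eq[OF sets_cantor_measure] by simp

lemma UNIV_not_null: "UNIV \<notin> null_sets cantor_measure"
  using cm.emeasure_space_1 by (auto simp: null_sets_def)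

lemma emeasure_cyl: "emeasure cantor_measure (cyl n s) = ennreal ((1/2) ^ n)"
proof -
  have "cyl n s = prod_emb UNIV (\<lambda>_. measure_pmf (bernoulli_pmf (1/2))) {..<n} (\<Pi>\<^sub>E i\<in>{..<n}. {s i})"
    by (rule set_eqI) (simp add: cyl_def prod_emb_def Pi_iff Ball_def)
  then have "emeasure cantor_measure (cyl n s) =
      (\<Prod>i<n. emeasure (measure_pmf (bernoulli_pmf (1/2))) {s i})"
    unfolding cantor_measure_def
    by (simp add: emeasure_PiM_emb measure_pmf.prob_space_axioms)
  also have "\<dots> = (\<Prod>i<n. ennreal (1/2))"
  proof (rule prod.cong[OF refl])
    fix i show "emeasure (measure_pmf (bernoulli_pmf (1/2))) {s i} = ennreal (1/2)"
      by (cases "s i") (simp_all add: emeasure_pmf_single)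
  qed
  also have "\<dots> = ennreal (1/2) ^ n"
    by (simp only: prod_constant card_lessThan)
  finally show ?thesis by (simp only: ennreal_power[of "1/2"] zero_le_divide_1_iff zero_le_numeral)
qed

section \<open>Cylinders determine Borel measures\<close>

text \<open>There are only countably many cylinders of each length, so every open set is a countable
  union of cylinders. The empty set is added to close the generator under intersections: two
  cylinders are disjoint or nested.\<close>

lemma sets_borel_eq_cyl: "sets (borel :: cantor measure) = sigma_sets UNIV (insert {} {cyl n s |n s. True})"
proof
  let ?E = "insert {} {cyl n s |n s. True}"
  have c: "countable (range (cyl n))" for n
  proof -
    have "range (cyl n) \<subseteq> (\<lambda>F. cyl n (\<lambda>i. i \<in> F)) ` {F. finite F}"
    proof clarify
      fix s
      have "cyl n s = cyl n (\<lambda>i. i \<in> {i. i < n \<and> s i})" by (auto simp: cyl_def)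
      moreover have "finite {i. i < n \<and> s i}" by simp
      ultimately show "cyl n s \<in> (\<lambda>F. cyl n (\<lambda>i. i \<in> F)) ` {F. finite F}" by blast
    qed
    moreover have "countable {F :: nat set. finite F}" by (rule countable_Collect_finite)
    ultimately show ?thesis by (metis countable_image countable_subset)
  qed
  have "U \<in> sigma_sets UNIV ?E" if "open U" for U
  proof -
    have eq: "U = (\<Union>n. \<Union>{C \<in> range (cyl n). C \<subseteq> U})"
    proof
      show "U \<subseteq> (\<Union>n. \<Union>{C \<in> range (cyl n). C \<subseteq> U})"
        using open_contains_cyl[OF that] mem_cyl_self by fast
    qed auto
    have "\<Union>{C \<in> range (cyl n). C \<subseteq> U} \<in> sigma_sets UNIV ?E" for n
    proof (rule sigma_algebra.countable_Union)
      show "sigma_algebra UNIV (sigma_sets UNIV ?E)" by (rule sigma_algebra_sigma_sets) auto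
    qed (use c in \<open>auto intro: countable_subset[OF _ c] sigma_sets.Basic\<close>)
    then show ?thesis by (subst eq) (rule sigma_sets.Union, auto)
  qed
  then have "Collect open \<subseteq> sigma_sets UNIV ?E" by auto
  then show "sets borel \<subseteq> sigma_sets UNIV ?E"
    by (simp add: borel_def sigma_sets_mono)
  show "sigma_sets UNIV ?E \<subseteq> sets borel"
  proof (rule sets.sigma_sets_subset[where M=borel, simplified])
    show "?E \<subseteq> sets borel" by (auto intro: borel_open open_cyl)
  qed
qed

lemma measure_eqI_cyl:
  assumes "sets M = sets borel" "sets N = sets borel" "finite_measure M"
    and eq: "\<And>n s. emeasure M (cyl n s) = emeasure N (cyl n s)"
  shows "M = N"
proof (rule measure_eqI_generator_eq)
  let ?E = "insert {} {cyl n s |n s. True}"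
  have int: "cyl n s \<inter> cyl m t \<in> ?E" if "n \<le> m" for n m s t
  proof (cases "cyl n s \<inter> cyl m t = {}")
    case False
    then obtain x where "x \<in> cyl n s" "x \<in> cyl m t" by auto
    then have "cyl m t \<subseteq> cyl n s" using that by (auto simp: cyl_def)
    then have "cyl n s \<inter> cyl m t = cyl m t" by auto
    then show ?thesis by auto
  qed auto
  show "Int_stable ?E"
  proof (rule Int_stableI)
    fix A B assume "A \<in> ?E" "B \<in> ?E"
    then consider "A = {} \<or> B = {}" | n m s t where "A = cyl n s" "B = cyl m t" by auto
    then show "A \<inter> B \<in> ?E"
    proof cases
      case 2 then show ?thesis
        using int[of n m s t] int[of m n t s] by (metis Int_commute nat_le_linear)
    qed auto
  qed
  show "range (\<lambda>_. UNIV) \<subseteq> ?E"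
  proof -
    have "UNIV = cyl 0 s" for s by (auto simp: cyl_def)
    then show ?thesis by blast
  qed
  show "sets M = sigma_sets UNIV ?E" "sets N = sigma_sets UNIV ?E"
    using assms sets_borel_eq_cyl by auto
  show "emeasure M UNIV \<noteq> \<infinity>"
    using finite_measure.emeasure_finite[OF assms(3)] by auto
qed (use eq in auto)

section \<open>Finite modifications and the zero-one law\<close>

text \<open>Translation by the characteristic function of \<open>F\<close> in the group of binary
  sequences with coordinatewise addition mod 2.\<close>

definition flip :: "nat set \<Rightarrow> cantor \<Rightarrow> cantor" where
  "flip F x = (\<lambda>i. x i \<noteq> (i \<in> F))"

lemma flip_flip [simp]: "flip F (flip F x) = x"
  by (auto simp: flip_def)

lemma vimage_flip_eq_image: "flip F -` A = flip F ` A"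
  by (force intro: rev_image_eqI)

lemma vimage_flip_cyl: "flip F -` cyl n s = cyl n (flip F s)"
  by (auto simp: cyl_def flip_def)

lemma measurable_flip [measurable]: "flip F \<in> borel \<rightarrow>\<^sub>M borel"
proof (rule borel_measurable_continuous_onI)
  have "continuous_on UNIV (\<lambda>x::cantor. (if i \<in> F then Not else id) (x i))" for i
    by (rule continuous_on_compose2[OF _ continuous_on_product_coordinates])
      (auto simp: continuous_on_open_vimage Topological_Spaces.open_discrete)
  then have "continuous_on UNIV (\<lambda>x::cantor. \<lambda>i. (if i \<in> F then Not else id) (x i))"
    by (rule continuous_on_coordinatewise_then_product)
  moreover have "flip F = (\<lambda>x i. (if i \<in> F then Not else id) (x i))"
    by (auto simp: flip_def fun_eq_iff)
  ultimately show "continuous_on UNIV (flip F)" by (simp only:)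
qed

lemma distr_flip: "distr cantor_measure cantor_measure (flip F) = cantor_measure"
proof (rule measure_eqI_cyl)
  fix n s
  show "emeasure (distr cantor_measure cantor_measure (flip F)) (cyl n s) = emeasure cantor_measure (cyl n s)"
    by (subst emeasure_distr) (auto simp: vimage_flip_cyl emeasure_cyl borel_open open_cyl)
qed (auto intro: cm.finite_measure_distr)

lemma emeasure_image_flip:
  assumes "A \<in> sets borel"
  shows "emeasure cantor_measure (flip F ` A) = emeasure cantor_measure A"
proof -
  have "emeasure (distr cantor_measure cantor_measure (flip F)) A = emeasure cantor_measure (flip F -` A)"
    using assms by (subst emeasure_distr) auto
  then show ?thesis by (simp add: distr_flip vimage_flip_eq_image)
qed

lemma sets_image_flip: "A \<in> sets borel \<Longrightarrow> flip F ` A \<in> sets borel"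
  using measurable_sets[OF measurable_flip, of A F] by (simp add: vimage_flip_eq_image)

text \<open>The saturation of \<open>A\<close> under equality at all but finitely many
  coordinates.\<close>

definition finite_flips :: "cantor set \<Rightarrow> cantor set" where
  "finite_flips A = (\<Union>F\<in>{F. finite F}. flip F ` A)"

lemma mem_finite_flips_iff: "x \<in> finite_flips A \<longleftrightarrow> (\<exists>F. finite F \<and> flip F x \<in> A)"
  by (simp add: finite_flips_def flip: vimage_flip_eq_image)

lemma sets_finite_flips: "A \<in> sets borel \<Longrightarrow> finite_flips A \<in> sets borel"
  unfolding finite_flips_def
  by (intro sets.countable_UN'' countable_Collect_finite sets_image_flip)

lemma null_finite_flips:
  assumes "A \<in> null_sets cantor_measure"
  shows "finite_flips A \<in> null_sets cantor_measure"
  unfolding finite_flips_def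
proof (intro null_sets_UN' countable_Collect_finite)
  fix F :: "nat set"
  have "A \<in> sets borel" using assms by (simp add: null_sets_def)
  then show "flip F ` A \<in> null_sets cantor_measure"
    using assms emeasure_image_flip[of A F] sets_image_flip[of A F] by (simp add: null_sets_def)
qed

lemma null_singleton: "{x} \<in> null_sets cantor_measure"
proof -
  have "emeasure cantor_measure {x} \<le> ennreal ((1/2)^n)" for n
    using emeasure_mono[of "{x}" "cyl n x" cantor_measure] by (simp add: emeasure_cyl borel_open open_cyl)
  moreover have "(\<lambda>n. ennreal ((1/2)^n)) \<longlonglongrightarrow> ennreal 0"
    by (intro tendsto_ennrealI LIMSEQ_power_zero) auto
  ultimately have "emeasure cantor_measure {x} \<le> ennreal 0"
    by (intro LIMSEQ_le_const) auto
  moreover have "{x} = (\<Inter>n. cyl n x)"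
    by (auto simp: cyl_def fun_eq_iff)
  then have "{x} \<in> sets borel" using borel_open[OF open_cyl] by auto
  ultimately show ?thesis by (auto simp: null_sets_def)
qed

text \<open>A set \<open>D\<close> invariant under finite flips is independent of every cylinder, hence of every Borel
  set; if it is disjoint from a set of positive measure, it is null.\<close>

lemma zero_one_finite_flips:
  assumes A: "A \<in> sets borel" and pos: "A \<notin> null_sets cantor_measure"
  shows "- finite_flips A \<in> null_sets cantor_measure"
proof -
  let ?M = cantor_measure
  define D where "D = - finite_flips A"
  have D [measurable]: "D \<in> sets borel"
    unfolding D_def using sets_finite_flips[OF A] by auto
  have inv: "flip F x \<in> D \<longleftrightarrow> x \<in> D" if "finite F" for F x
  proof -
    have "flip F x \<in> finite_flips A" if "x \<in> finite_flips A" "finite F" for x F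
    proof -
      from that(1) obtain G where G: "finite G" "flip G x \<in> A"
        unfolding mem_finite_flips_iff by (elim exE conjE)
      \<comment> \<open>Flips compose by symmetric difference of their sets.\<close>
      have "flip ((F - G) \<union> (G - F)) (flip F x) = flip G x" by (auto simp: flip_def)
      then show ?thesis
        using that(2) G unfolding mem_finite_flips_iff by (intro exI[of _ "(F - G) \<union> (G - F)"]) simp
    qed
    from this[of x F] this[of "flip F x" F] that show ?thesis by (auto simp: D_def)
  qed
  have shift: "measure ?M (D \<inter> cyl n s) = measure ?M (D \<inter> cyl n t)" for n s t
  proof -
    \<comment> \<open>Flipping the coordinates where \<open>s\<close> and \<open>t\<close> differ
      carries one cylinder to the other and preserves both \<open>D\<close> and the measure.\<close>
    define F where "F = {i. i < n \<and> s i \<noteq> t i}"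
    have "finite F" by (simp add: F_def)
    have "x \<in> cyl n s \<longleftrightarrow> flip F x \<in> cyl n t" for x
      by (auto simp: F_def flip_def cyl_def)
    then have "D \<inter> cyl n s = flip F -` (D \<inter> cyl n t)" using inv[OF \<open>finite F\<close>] by auto
    moreover have "D \<inter> cyl n t \<in> sets borel" by (simp add: borel_open open_cyl)
    ultimately show ?thesis
      by (simp only: vimage_flip_eq_image measure_def emeasure_image_flip)
  qed
  have prod: "measure ?M (D \<inter> cyl n s) = measure ?M D * (1/2)^n" for n s
  proof (induction n)
    case 0 then show ?case by (simp add: cyl_def)
  next
    case (Suc n)
    \<comment> \<open>The two halves of the cylinder carry equal parts of \<open>D\<close> by
      \<open>shift\<close>.\<close>
    let ?t = "s(n := \<not> s n)"
    have "D \<inter> cyl n s = (D \<inter> cyl (Suc n) s) \<union> (D \<inter> cyl (Suc n) ?t)"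
      by (auto simp: cyl_def less_Suc_eq)
    moreover have "(D \<inter> cyl (Suc n) s) \<inter> (D \<inter> cyl (Suc n) ?t) = {}"
      by (auto simp: cyl_def)
    ultimately have "measure ?M (D \<inter> cyl n s) =
        measure ?M (D \<inter> cyl (Suc n) s) + measure ?M (D \<inter> cyl (Suc n) ?t)"
      by (simp add: cm.finite_measure_Union borel_open open_cyl)
    then show ?case using Suc shift[of "Suc n" s ?t] by simp
  qed
  have "density ?M (indicator D) = density ?M (\<lambda>_. emeasure ?M D)"
  proof (rule measure_eqI_cyl)
    fix n s
    have c: "cyl n s \<in> sets borel" by (simp add: borel_open open_cyl)
    have "emeasure (density ?M (indicator D)) (cyl n s) = emeasure ?M (D \<inter> cyl n s)"
      using c D by (simp add: emeasure_restricted)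
    also have "\<dots> = ennreal (measure ?M D * (1/2)^n)"
      by (simp only: cm.emeasure_eq_measure prod)
    also have "\<dots> = emeasure ?M D * emeasure ?M (cyl n s)"
      by (simp only: emeasure_cyl cm.emeasure_eq_measure[of D] ennreal_mult' measure_nonneg)
    also have "\<dots> = emeasure (density ?M (\<lambda>_. emeasure ?M D)) (cyl n s)"
      using c by (simp add: emeasure_density_const)
    finally show "emeasure (density ?M (indicator D)) (cyl n s) = emeasure (density ?M (\<lambda>_. emeasure ?M D)) (cyl n s)" .
  next
    show "finite_measure (density ?M (indicator D))"
      by (rule cm.finite_measure_restricted) simp
  qed auto
  then have "emeasure (density ?M (indicator D)) A = emeasure (density ?M (\<lambda>_. emeasure ?M D)) A" by simp
  moreover have "emeasure (density ?M (indicator D)) A = emeasure ?M (D \<inter> A)"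
    using A D by (simp add: emeasure_restricted)
  moreover have "emeasure (density ?M (\<lambda>_. emeasure ?M D)) A = emeasure ?M D * emeasure ?M A"
    using A by (simp add: emeasure_density_const)
  moreover have "D \<inter> A = {}"
  proof -
    have "x \<in> finite_flips A" if "x \<in> A" for x
      unfolding mem_finite_flips_iff using that by (intro exI[of _ "{}"]) (simp add: flip_def)
    then show ?thesis by (auto simp: D_def)
  qed
  ultimately have "emeasure ?M D * emeasure ?M A = 0" by simp
  then have "emeasure ?M D = 0" using pos A by (auto simp: null_sets_def)
  then show ?thesis using D by (auto simp: null_sets_def D_def)
qed

section \<open>Cardinals below the continuum\<close>

lemma cantor_ordIso_continuum: "|UNIV :: cantor set| =o continuum"
proof -
  have "bij_betw (Collect :: cantor \<Rightarrow> nat set) UNIV UNIV"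
    by (rule bij_betw_byWitness[of _ "\<lambda>A n. n \<in> A"]) auto
  moreover obtain g :: "nat set \<Rightarrow> real" where "bij_betw g UNIV UNIV"
    using nat_sets_eqpoll_reals by (auto simp: eqpoll_def)
  ultimately have "bij_betw (g \<circ> Collect) (UNIV :: cantor set) UNIV"
    by (rule bij_betw_trans)
  then show ?thesis unfolding continuum_def using card_of_ordIso by blast
qed

lemma infinite_UNIV_cantor: "infinite (UNIV :: cantor set)"
proof -
  have "inj (\<lambda>n i :: nat. i = n)" by (auto simp: inj_def fun_eq_iff)
  then have "infinite (range (\<lambda>n i :: nat. i = n))" by (rule range_inj_infinite)
  then show ?thesis by (rule infinite_super[OF subset_UNIV])
qed

section \<open>Coding open sets by points of the Cantor space\<close>

text \<open>A binary sequence codes the union of those members of a countable basis that it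
  selects.\<close>

lemma ex_surj_open_sets:
  "\<exists>\<rho> :: cantor \<Rightarrow> 'a::second_countable_topology set. range \<rho> = {U. open U}"
proof -
  obtain \<B> :: "'a set set" where \<B>: "countable \<B>" "topological_basis \<B>"
    using ex_countable_basis by (elim exE conjE)
  define B where "B = from_nat_into (insert {} \<B>)"
  have B: "range B = insert {} \<B>"
    unfolding B_def using \<B>(1) by (intro range_from_nat_into) auto
  have "\<exists>s. U = (\<Union>n\<in>{n. s n}. B n)" if "open U" for U
  proof -
    from \<B>(2) that obtain \<C> where \<C>: "\<C> \<subseteq> \<B>" "\<Union>\<C> = U"
      unfolding topological_basis_def by metis
    have "U = (\<Union>n\<in>{n. B n \<in> \<C>}. B n)"
    proof
      show "U \<subseteq> (\<Union>n\<in>{n. B n \<in> \<C>}. B n)"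
      proof
        fix x assume "x \<in> U"
        then obtain C where C: "C \<in> \<C>" "x \<in> C" using \<C>(2) by auto
        then have "C \<in> range B" using B \<C>(1) by auto
        then show "x \<in> (\<Union>n\<in>{n. B n \<in> \<C>}. B n)" using C by auto
      qed
    qed (use \<C>(2) in auto)
    then show ?thesis by (rule exI[of _ "\<lambda>n. B n \<in> \<C>"])
  qed
  moreover have "open (\<Union>n\<in>{n. s n}. B n)" for s
  proof (intro open_UN ballI)
    fix n
    have "B n \<in> insert {} \<B>" using B by (metis rangeI)
    then show "open (B n)" using topological_basis_open[OF \<B>(2)] by auto
  qed
  ultimately have "range (\<lambda>s. \<Union>n\<in>{n. s n}. B n) = {U. open U}" by fastforce
  then show ?thesis by (intro exI[of _ "\<lambda>s. \<Union>n\<in>{n. s n}. B n"])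
qed

lemma ex_surj_open_seqs:
  "\<exists>\<rho> :: cantor \<Rightarrow> nat \<Rightarrow> 'a::second_countable_topology set. range \<rho> = {W. \<forall>n. open (W n)}"
proof -
  obtain u :: "cantor \<Rightarrow> 'a set" where u: "range u = {U. open U}"
    using ex_surj_open_sets by blast
  \<comment> \<open>Row \<open>n\<close> of \<open>s\<close>, read as a matrix through
    \<open>prod_encode\<close>, codes the \<open>n\<close>-th open set.\<close>
  let ?\<rho> = "\<lambda>s n. u (\<lambda>m. s (prod_encode (n, m)))"
  have "W \<in> range ?\<rho>" if W: "\<forall>n. open (W n)" for W
  proof -
    have "\<forall>n. \<exists>t. W n = u t" using W u by (metis mem_Collect_eq rangeE)
    then obtain t where "\<And>n. W n = u (t n)" by metis
    then have "W = ?\<rho> (\<lambda>k. t (fst (prod_decode k)) (snd (prod_decode k)))" by auto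
    then show ?thesis by (rule range_eqI[of W ?\<rho> "\<lambda>k. t (fst (prod_decode k)) (snd (prod_decode k))"])
  qed
  moreover have "open (?\<rho> s n)" for s n using u by auto
  ultimately have "range ?\<rho> = {W. \<forall>n. open (W n)}" by (intro equalityI subsetI) auto
  then show ?thesis by (intro exI[of _ ?\<rho>])
qed

lemma card_insert_less_infinite:
  assumes "|A| <o |B|" "infinite B"
  shows "|insert a A| <o |B|"
proof -
  have "|{a}| <o |B|"
    using assms(2) finite_iff_ordLess_natLeq[of "{a}"] infinite_iff_natLeq_ordLeq[of B] ordLess_ordLeq_trans
    by blast
  from card_of_Un_ordLess_infinite[OF assms(2) this assms(1)] show ?thesis by simp
qed

section \<open>Consequences of the cardinal hypotheses\<close>

text \<open>If few null sets covered \<open>K\<close>, their saturations would cover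
  \<open>finite_flips K\<close>. Its complement is null by the zero-one law, so few null sets would
  cover the whole space.\<close>

lemma not_covered_by_few_null_sets:
  assumes cov: "cov_null =o continuum"
    and K: "K \<in> sets borel" "K \<notin> null_sets cantor_measure"
    and \<A>: "\<A> \<subseteq> null_sets cantor_measure" "|\<A>| <o |UNIV :: cantor set|"
  shows "\<not> K \<subseteq> \<Union>\<A>"
proof
  assume sub: "K \<subseteq> \<Union>\<A>"
  define \<N> where "\<N> = insert (- finite_flips K) (finite_flips ` \<A>)"
  have "|\<N>| <o |UNIV :: cantor set|"
    unfolding \<N>_def
    by (rule card_insert_less_infinite[OF ordLeq_ordLess_trans[OF card_of_image \<A>(2)] infinite_UNIV_cantor])
  moreover have "cov_null \<le>o |\<N>|"
  proof -
    have "\<N> \<subseteq> null_sets cantor_measure"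
      using \<A>(1) null_finite_flips zero_one_finite_flips[OF K] by (auto simp: \<N>_def)
    then have "\<N> \<subseteq> null_sets (completion cantor_measure)"
      using null_sets_completionI by blast
    moreover have "x \<in> \<Union>\<N>" for x
    proof (cases "x \<in> finite_flips K")
      case True
      then obtain F where F: "finite F" "flip F x \<in> K"
        unfolding mem_finite_flips_iff by (elim exE conjE)
      then obtain A where "A \<in> \<A>" "flip F x \<in> A" using sub by auto
      then have "x \<in> finite_flips A" "finite_flips A \<in> \<N>"
        using F(1) by (auto simp: mem_finite_flips_iff \<N>_def)
      then show ?thesis by (rule UnionI[rotated])
    qed (simp add: \<N>_def)
    then have "\<Union>\<N> = UNIV" by auto
    ultimately show ?thesis
      using min_card[of "{\<N>. \<N> \<subseteq> null_sets (completion cantor_measure) \<and> \<Union>\<N> = UNIV}"]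
      unfolding cov_null_def by blast
  qed
  moreover have "cov_null =o |UNIV :: cantor set|"
    using cov cantor_ordIso_continuum ordIso_symmetric ordIso_transitive by blast
  ultimately show False
    by (meson not_ordLess_ordLeq ordIso_ordLeq_trans ordIso_symmetric ordLess_ordLeq_trans ordLess_irreflexive)
qed

lemma few_functions_dominated:
  assumes b: "bounding_number =o continuum" and B: "|B| <o |UNIV :: cantor set|"
  shows "\<exists>g. \<forall>f\<in>B. f \<le>* g"
proof (rule ccontr)
  assume "\<not> ?thesis"
  then have "bounding_number \<le>o |B|"
    using min_card[of "{B. \<not> (\<exists>g. \<forall>f\<in>B. f \<le>* g)}"] unfolding bounding_number_def by blast
  moreover have "bounding_number =o |UNIV :: cantor set|"
    using b cantor_ordIso_continuum ordIso_symmetric ordIso_transitive by blast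
  ultimately show False
    using B by (meson not_ordLess_ordLeq ordIso_ordLeq_trans ordIso_symmetric)
qed

section \<open>Vertical sections\<close>

text \<open>The sections of an open set contain compact sets of almost the same measure, so by the tube
  lemma their measure is a lower semicontinuous function of the base point.\<close>

lemma ex_uniform_measure_bound:
  fixes U :: "nat \<Rightarrow> ('a::topological_space \<times> cantor) set"
  assumes comp: "compact (UNIV :: 'a set)" and op: "\<And>k. open (U k)" and inc: "incseq U"
    and full: "\<And>x. emeasure cantor_measure (Pair x -` (\<Union>k. U k)) = 1"
    and e: "e < 1"
  shows "\<exists>k. \<forall>x. measure cantor_measure (Pair x -` U k) > e"
proof -
  let ?\<mu> = "measure cantor_measure"
  have ops: "open (Pair x -` U k)" for x k
    using op by (intro open_vimage continuous_intros) auto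
  have local_bound: "\<exists>k Q. open Q \<and> x \<in> Q \<and> (\<forall>z\<in>Q. ?\<mu> (Pair z -` U k) > e)" for x
  proof -
    have "(\<lambda>k. ?\<mu> (Pair x -` U k)) \<longlonglongrightarrow> ?\<mu> (\<Union>k. Pair x -` U k)"
    proof (rule cm.finite_Lim_measure_incseq)
      show "incseq (\<lambda>k. Pair x -` U k)" using inc by (auto simp: incseq_def)
    qed (use ops in \<open>auto intro: borel_open\<close>)
    moreover have "?\<mu> (\<Union>k. Pair x -` U k) = 1"
      using full[of x] by (simp add: measure_def vimage_UN)
    ultimately have "\<forall>\<^sub>F k in sequentially. ?\<mu> (Pair x -` U k) > e"
      using e by (intro order_tendstoD) auto
    then obtain k where k: "?\<mu> (Pair x -` U k) > e" by (auto simp: eventually_sequentially)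
    \<comment> \<open>\<open>C j\<close> is the union of the cylinders of length \<open>j\<close>
      inside the section: these sets are clopen and increase to the section.\<close>
    define C where "C j = {y. cyl j y \<subseteq> Pair x -` U k}" for j
    have cl: "closed (C j)" for j
    proof (rule closed_if_saturated[where n=j], rule subsetI)
      fix y z assume "y \<in> C j" "z \<in> cyl j y"
      moreover from this have "cyl j z = cyl j y" by (auto simp: cyl_def)
      ultimately show "z \<in> C j" by (simp add: C_def)
    qed
    have "(\<lambda>j. ?\<mu> (C j)) \<longlonglongrightarrow> ?\<mu> (\<Union>j. C j)"
    proof (rule cm.finite_Lim_measure_incseq)
      show "incseq C"
      proof (intro incseq_SucI subsetI)
        fix j y assume "y \<in> C j"
        moreover have "cyl (Suc j) y \<subseteq> cyl j y" by (auto simp: cyl_def)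
        ultimately show "y \<in> C (Suc j)" by (auto simp: C_def)
      qed
    qed (use cl in \<open>auto intro: borel_closed\<close>)
    moreover have "(\<Union>j. C j) = Pair x -` U k"
    proof
      show "(\<Union>j. C j) \<subseteq> Pair x -` U k" using mem_cyl_self by (auto simp: C_def)
      show "Pair x -` U k \<subseteq> (\<Union>j. C j)"
      proof
        fix y assume "y \<in> Pair x -` U k"
        then obtain j where "cyl j y \<subseteq> Pair x -` U k" using open_contains_cyl[OF ops] by metis
        then show "y \<in> (\<Union>j. C j)" by (auto simp: C_def)
      qed
    qed
    ultimately have "\<forall>\<^sub>F j in sequentially. ?\<mu> (C j) > e"
      using k by (intro order_tendstoD) auto
    then obtain j where j: "?\<mu> (C j) > e" by (auto simp: eventually_sequentially)
    have "C j \<subseteq> Pair x -` U k" using mem_cyl_self by (auto simp: C_def)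
    then have "{x} \<times> C j \<subseteq> U k" by auto
    then obtain Q where Q: "x \<in> Q" "open Q" "Q \<times> C j \<subseteq> U k"
      using Elementary_Topology.tube_lemma[OF closed_imp_compact_cantor[OF cl] op] by metis
    have "?\<mu> (Pair z -` U k) > e" if "z \<in> Q" for z
    proof -
      have "C j \<subseteq> Pair z -` U k" using Q(3) that by auto
      then have "?\<mu> (C j) \<le> ?\<mu> (Pair z -` U k)"
        using ops by (intro cm.finite_measure_mono) (auto intro: borel_open)
      then show ?thesis using j by simp
    qed
    then show ?thesis using Q by blast
  qed
  then obtain k Q where kQ: "\<And>x. open (Q x)" "\<And>x. x \<in> Q x" "\<And>x z. z \<in> Q x \<Longrightarrow> ?\<mu> (Pair z -` U (k x)) > e"
    by metis
  \<comment> \<open>Finitely many of the neighbourhoods cover the base, and by monotonicity the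
    largest of their indices serves every line.\<close>
  obtain D where D: "finite D" "UNIV \<subseteq> (\<Union>x\<in>D. Q x)"
    using compactE_image[OF comp, of UNIV Q] kQ by (metis UNIV_I UN_I subsetI)
  have "?\<mu> (Pair z -` U (Max (k ` D))) > e" for z
  proof -
    obtain x where x: "x \<in> D" "z \<in> Q x" using D by blast
    then have "U (k x) \<subseteq> U (Max (k ` D))" using D(1) by (intro incseqD[OF inc] Max_ge) auto
    then have "?\<mu> (Pair z -` U (k x)) \<le> ?\<mu> (Pair z -` U (Max (k ` D)))"
      using ops by (intro cm.finite_measure_mono) (auto intro: borel_open)
    then show ?thesis using kQ(3)[OF x(2)] by simp
  qed
  then show ?thesis by blast
qed

text \<open>The \<open>limsup\<close> of the complements of the \<open>W n\<close>. The points
  outside it lie in almost all \<open>W n\<close>, as a gamma-cover demands.\<close>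

definition frequently_outside :: "(nat \<Rightarrow> 'a set) \<Rightarrow> 'a set" where
  "frequently_outside W = {p. \<exists>\<^sub>F n in sequentially. p \<notin> W n}"

text \<open>The complements of the sections have summable measures, so the Borel-Cantelli lemma
  applies on each line.\<close>

lemma null_section_frequently_outside:
  assumes op: "\<And>n. open (W n)" 
    and bound: "\<And>n. measure cantor_measure (Pair x -` W n) > 1 - (1/2)^n"
  shows "Pair x -` frequently_outside W \<in> null_sets cantor_measure"
proof -
  let ?A = "\<lambda>n. - (Pair x -` W n)"
  have ops: "open (Pair x -` W n)" for n
    using op by (intro open_vimage continuous_intros) auto
  have A: "?A n \<in> sets borel" for n using ops by (auto intro: borel_open)
  have "AE v in cantor_measure. \<forall>\<^sub>F n in sequentially. v \<in> space cantor_measure - ?A n"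
  proof (rule borel_cantelli_AE1)
    show "summable (\<lambda>n. measure cantor_measure (?A n))"
    proof (rule summable_comparison_test')
      show "summable (\<lambda>n. (1/2::real)^n)" by (rule summable_geometric) simp
      fix n
      have "measure cantor_measure (?A n) = 1 - measure cantor_measure (Pair x -` W n)"
        using cm.prob_compl[of "Pair x -` W n"] ops by (simp add: Compl_eq_Diff_UNIV borel_open)
      then show "norm (measure cantor_measure (?A n)) \<le> (1/2)^n" using bound[of n] by simp
    qed
  qed (use A in \<open>auto simp: cm.emeasure_eq_measure\<close>)
  then have "AE v in cantor_measure. v \<notin> Pair x -` frequently_outside W"
    by (simp add: frequently_outside_def not_frequently)
  moreover have "Pair x -` frequently_outside W \<in> sets borel"
  proof -
    have "Pair x -` frequently_outside W = (\<Inter>m. \<Union>n\<in>{m..}. ?A n)"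
      by (auto simp: frequently_outside_def frequently_sequentially)
    then show ?thesis using A by auto
  qed
  ultimately show ?thesis by (simp add: AE_iff_null_sets)
qed

section \<open>The generic set\<close>

text \<open>One binary sequence codes a whole triple: coordinate 0 is the label, the odd coordinates
  form the point, and the remaining even ones code the complement of the closed set.\<close>

lemma ex_enumeration_of_targets:
  "\<exists>(x :: cantor \<Rightarrow> cantor) K (b :: cantor \<Rightarrow> bool).
     (\<forall>a. closed (K a) \<and> K a \<notin> null_sets cantor_measure) \<and>
     (\<forall>x' K' b'. closed K' \<longrightarrow> K' \<notin> null_sets cantor_measure \<longrightarrow> (\<exists>a. x a = x' \<and> K a = K' \<and> b a = b'))"
proof -
  obtain u :: "cantor \<Rightarrow> cantor set" where u: "range u = {U. open U}"
    using ex_surj_open_sets by blast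
  \<comment> \<open>Codes of null sets are sent to \<open>UNIV\<close>, so that \<open>K a\<close>
    is nonnull for every \<open>a\<close>.\<close>
  define K where "K a = (let C = - u (\<lambda>n. a (2 * n + 2)) in if C \<in> null_sets cantor_measure then UNIV else C)"
    for a :: cantor
  have "open (u t)" for t using u by auto
  with UNIV_not_null have K: "closed (K a) \<and> K a \<notin> null_sets cantor_measure" for a
    by (auto simp: K_def Let_def closed_Compl)
  have "\<exists>a. (\<lambda>n. a (2 * n + 1)) = x' \<and> K a = K' \<and> a 0 = b'"
    if K': "closed K'" "K' \<notin> null_sets cantor_measure" for x' :: cantor and K' b'
  proof -
    have "- K' \<in> range u" using K'(1) u by auto
    then obtain t where t: "u t = - K'" by auto
    define a where "a n = (if n = 0 then b' else if odd n then x' ((n - 1) div 2) else t ((n - 2) div 2))" for n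
    have "(\<lambda>n. a (2 * n + 1)) = x'" "(\<lambda>n. a (2 * n + 2)) = t" "a 0 = b'" by (auto simp: a_def)
    then show ?thesis using t K'(2) by (intro exI[of _ a]) (auto simp: K_def Let_def)
  qed
  with K show ?thesis
    by (intro exI[of _ "\<lambda>a n. a (2 * n + 1)"] exI[of _ K] exI[of _ "\<lambda>a. a 0"]) blast
qed

text \<open>The label \<open>b\<close> splits the points into two disjoint families, each of which meets every
  closed nonnull set in every vertical section.\<close>

lemma ex_generic_points:
  assumes cov: "cov_null =o continuum"
  shows "\<exists>(x :: cantor \<Rightarrow> cantor) y (b :: cantor \<Rightarrow> bool). inj y \<and>
    (\<forall>x' K b'. closed K \<longrightarrow> K \<notin> null_sets cantor_measure \<longrightarrow> (\<exists>a. x a = x' \<and> y a \<in> K \<and> b a = b')) \<and>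
    (\<forall>W. (\<forall>n. open (W n)) \<longrightarrow> (\<forall>x'. Pair x' -` frequently_outside W \<in> null_sets cantor_measure) \<longrightarrow>
       |{a. (x a, y a) \<in> frequently_outside W}| <o |UNIV :: cantor set| )"
proof -
  obtain x :: "cantor \<Rightarrow> cantor" and K and b :: "cantor \<Rightarrow> bool"
    where K: "\<And>a. closed (K a)" "\<And>a. K a \<notin> null_sets cantor_measure"
    and targets: "\<And>x' K' b'. closed K' \<Longrightarrow> K' \<notin> null_sets cantor_measure \<Longrightarrow>
      \<exists>a. x a = x' \<and> K a = K' \<and> b a = b'"
    using ex_enumeration_of_targets by metis
  obtain \<rho> :: "cantor \<Rightarrow> nat \<Rightarrow> (cantor \<times> cantor) set" where \<rho>: "range \<rho> = {W. \<forall>n. open (W n)}"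
    using ex_surj_open_seqs by blast
  \<comment> \<open>The default \<open>{}\<close> makes \<open>N a x'\<close> null for every code,
    including the sequences with some nonnull section.\<close>
  define N where "N a x' = (if Pair x' -` frequently_outside (\<rho> a) \<in> null_sets cantor_measure
    then Pair x' -` frequently_outside (\<rho> a) else {})" for a x'
  have N: "N a x' \<in> null_sets cantor_measure" for a x' by (simp add: N_def)
  define r where "r = |UNIV :: cantor set|"
  have cr: "Card_order r" unfolding r_def by (rule card_of_Card_order)
  then have wo: "Well_order r" unfolding card_order_on_def by (rule conjunct1)
  have Fr: "Field r = UNIV" unfolding r_def by (rule Field_card_of)
  have seg: "|underS r a| <o |UNIV :: cantor set|" for a
    using card_of_underS[OF cr, of a] by (simp add: Fr, simp add: r_def)
  \<comment> \<open>The recursion runs along a well-order of type continuum: \<open>y a\<close> lies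
    in its target and avoids all earlier values and, on the line over \<open>x a\<close>, all
    earlier \<open>limsup\<close> sets.\<close>
  define P where "P f a v \<longleftrightarrow> v \<in> K a \<and> (\<forall>c\<in>underS r a. v \<noteq> f c \<and> v \<notin> N c (x a))" for f :: "cantor \<Rightarrow> cantor" and a v
  have "\<exists>y. \<forall>a. P y a (y a)"
  proof (rule dependent_wf_choice)
    show "wf (r - Id)" using wo by (simp add: well_order_on_def)
    show "P f a v = P g a v" if "\<And>z. (z, a) \<in> r - Id \<Longrightarrow> f z = g z" for f g a v
      using that by (auto simp: P_def underS_def)
    show "\<exists>v. P f a v" for f a
    proof -
      \<comment> \<open>Each earlier value is absorbed into a null set, which leaves one null set
        for each predecessor of \<open>a\<close>.\<close>
      let ?\<A> = "(\<lambda>c. insert (f c) (N c (x a))) ` underS r a"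
      have "\<not> K a \<subseteq> \<Union>?\<A>"
      proof (rule not_covered_by_few_null_sets[OF cov])
        show "?\<A> \<subseteq> null_sets cantor_measure"
          using null_sets.Un[OF null_singleton N] by auto
        show "|?\<A>| <o |UNIV :: cantor set|"
          using ordLeq_ordLess_trans[OF card_of_image seg] .
      qed (use K in \<open>auto intro: borel_closed\<close>)
      then show ?thesis by (auto simp: P_def)
    qed
  qed
  then obtain y where y: "\<And>a. y a \<in> K a" "\<And>a c. c \<in> underS r a \<Longrightarrow> y a \<noteq> y c \<and> y a \<notin> N c (x a)"
    by (auto simp: P_def)
  have compare: "c \<in> underS r a \<or> a = c \<or> a \<in> underS r c" for a c
    using wo Fr by (auto simp: underS_def well_order_on_def linear_order_on_def total_on_def)
  have inj: "inj y"
    using compare y(2) by (intro injI) metis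
  have meets: "\<exists>a. x a = x' \<and> y a \<in> K' \<and> b a = b'"
    if "closed K'" "K' \<notin> null_sets cantor_measure" for x' K' b'
    using targets[OF that] y(1) by metis
  have few: "|{a. (x a, y a) \<in> frequently_outside W}| <o |UNIV :: cantor set|"
    if W: "\<forall>n. open (W n)" "\<forall>x'. Pair x' -` frequently_outside W \<in> null_sets cantor_measure" for W
  proof -
    have "W \<in> range \<rho>" using W(1) \<rho> by simp
    then obtain c where c: "W = \<rho> c" by auto
    \<comment> \<open>Every point chosen after stage \<open>c\<close> avoids the
      \<open>limsup\<close> set coded by \<open>c\<close>.\<close>
    have "a \<in> insert c (underS r c)" if "(x a, y a) \<in> frequently_outside W" for a
      using compare[of c a] y(2)[of c a] that W(2) by (auto simp: N_def c)
    then have "{a. (x a, y a) \<in> frequently_outside W} \<subseteq> insert c (underS r c)" by blast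
    then show ?thesis
      by (rule ordLeq_ordLess_trans[OF card_of_mono1 card_insert_less_infinite[OF seg infinite_UNIV_cantor]])
  qed
  show ?thesis
    by (rule exI[of _ x], rule exI[of _ y], rule exI[of _ b])
      (intro conjI allI impI inj meets few; simp)
qed

section \<open>Covering properties of the generic set\<close>

lemma ex_countable_subcover_sequence:
  fixes X :: "'a::second_countable_topology set"
  assumes "\<U> \<in> open_covers X" "X \<noteq> {}"
  shows "\<exists>e. range e \<subseteq> \<U> \<and> X \<subseteq> (\<Union>n::nat. e n)"
proof -
  obtain \<V> where \<V>: "\<V> \<subseteq> \<U>" "countable \<V>" "\<Union>\<V> = \<Union>\<U>"
    using assms Lindelof[of \<U>] by (auto simp: open_covers_def)
  then have X: "X \<subseteq> \<Union>\<V>" using assms(1) by (simp add: open_covers_def)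
  then have "\<V> \<noteq> {}" using assms(2) by auto
  with \<V> X show ?thesis
    by (intro exI[of _ "from_nat_into \<V>"]) (simp add: range_from_nat_into)
qed

lemma hurewicz_of_generic:
  fixes X :: "(cantor \<times> cantor) set"
  assumes b: "bounding_number =o continuum"
    and meets: "\<And>x K. closed K \<Longrightarrow> K \<notin> null_sets cantor_measure \<Longrightarrow> \<exists>v\<in>K. (x, v) \<in> X"
    and few: "\<And>W. (\<And>n. open (W n)) \<Longrightarrow> (\<And>x. Pair x -` frequently_outside W \<in> null_sets cantor_measure) \<Longrightarrow>
      |X \<inter> frequently_outside W| <o |UNIV :: cantor set|"
  shows "hurewicz X"
  unfolding hurewicz_def
proof (intro allI impI)
  fix \<U> :: "nat \<Rightarrow> (cantor \<times> cantor) set set"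
  assume \<U>: "\<forall>n. \<U> n \<in> open_covers X"
  have "X \<noteq> {}" using meets[OF closed_UNIV UNIV_not_null] by blast
  then have "\<forall>n. \<exists>e. range e \<subseteq> \<U> n \<and> X \<subseteq> (\<Union>k::nat. e k)"
    using \<U> by (intro allI ex_countable_subcover_sequence[OF _ \<open>X \<noteq> {}\<close>]) simp
  then obtain e where e: "\<And>n. range (e n) \<subseteq> \<U> n" "\<And>n. X \<subseteq> (\<Union>k::nat. e n k)" by metis
  \<comment> \<open>Finite unions make the sequences increasing; index \<open>k\<close> stands for
    the finite subfamily \<open>e n\<close> on \<open>{..k}\<close>.\<close>
  define U where "U n k = (\<Union>i\<le>k. e n i)" for n k
  have op: "open (U n k)" for n k
    using e(1)[of n] \<U> by (auto simp: U_def open_covers_def)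
  have inc: "incseq (U n)" for n by (force simp: incseq_def U_def)
  have cover: "X \<subseteq> (\<Union>k. U n k)" for n using e(2)[of n] by (force simp: U_def)
  have "\<exists>k. \<forall>x. measure cantor_measure (Pair x -` U n k) > 1 - (1/2)^n" for n
  proof (rule ex_uniform_measure_bound[OF compact_UNIV_cantor op inc])
    fix x :: cantor
    let ?V = "Pair x -` (\<Union>k. U n k)"
    have V: "open ?V" using op by (intro open_vimage continuous_intros open_UN) auto
    \<comment> \<open>The uncovered part of the line is closed and disjoint from \<open>X\<close>,
      while \<open>X\<close> meets every closed nonnull set on that line.\<close>
    have "- ?V \<in> null_sets cantor_measure"
    proof (rule ccontr)
      assume "\<not> ?thesis"
      then obtain v where "v \<in> - ?V" "(x, v) \<in> X" using meets[of "- ?V" x] V by (auto simp: closed_Compl)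
      then show False using cover[of n] by auto
    qed
    then show "emeasure cantor_measure ?V = 1"
      using cm.prob_compl[of ?V] V
      by (auto simp: null_sets_def cm.emeasure_eq_measure Compl_eq_Diff_UNIV borel_open)
  qed simp
  then obtain f0 where f0: "\<And>n x. measure cantor_measure (Pair x -` U n (f0 n)) > 1 - (1/2)^n"
    by metis
  \<comment> \<open>\<open>E\<close> collects the points for which the selection \<open>f0\<close>
    fails; domination of their functions \<open>h p\<close> repairs this.\<close>
  define E where "E = X \<inter> frequently_outside (\<lambda>n. U n (f0 n))"
  have E: "|E| <o |UNIV :: cantor set|"
    unfolding E_def using op f0 by (intro few null_section_frequently_outside) auto
  define h where "h p n = (LEAST k. p \<in> U n k)" for p n
  have h: "p \<in> U n (h p n)" if "p \<in> X" for p n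
  proof -
    from cover[of n] that obtain k where "p \<in> U n k" by auto
    then show ?thesis unfolding h_def by (rule LeastI)
  qed
  from few_functions_dominated[OF b ordLeq_ordLess_trans[OF card_of_image[where f=h] E]]
  obtain g where g: "\<forall>f\<in>h ` E. f \<le>* g"
    by (elim exE)
  \<comment> \<open>Since the \<open>U n\<close> increase, the maximum serves the points of
    \<open>E\<close> and the others alike.\<close>
  define m where "m n = max (f0 n) (g n)" for n
  have ev: "\<forall>\<^sub>F n in sequentially. p \<in> U n (m n)" if p: "p \<in> X" for p
  proof (cases "p \<in> E")
    case True
    then have "\<forall>\<^sub>F n in sequentially. h p n \<le> g n" using g by (simp add: eventually_dominated_def)
    then show ?thesis
    proof eventually_elim
      case (elim n)
      then have "U n (h p n) \<subseteq> U n (m n)" by (intro incseqD[OF inc]) (simp add: m_def)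
      then show ?case using h[OF p] by auto
    qed
  next
    case False
    then have "\<forall>\<^sub>F n in sequentially. p \<in> U n (f0 n)"
      using p by (simp add: E_def frequently_outside_def not_frequently)
    then show ?thesis
    proof eventually_elim
      case (elim n)
      moreover have "U n (f0 n) \<subseteq> U n (m n)" by (intro incseqD[OF inc]) (simp add: m_def)
      ultimately show ?case by auto
    qed
  qed
  show "\<exists>\<F>. (\<forall>n. finite (\<F> n) \<and> \<F> n \<subseteq> \<U> n) \<and> gamma_cover (\<lambda>n. \<Union>(\<F> n)) X"
  proof (intro exI[of _ "\<lambda>n. e n ` {..m n}"] conjI allI)
    have "finite (- {n. p \<in> U n (m n)})" if "p \<in> X" for p
      using ev[OF that] by (simp add: eventually_cofinite Collect_neg_eq flip: cofinite_eq_sequentially)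
    then show "gamma_cover (\<lambda>n. \<Union>(e n ` {..m n})) X"
      by (simp add: gamma_cover_def U_def)
  qed (use e(1) in auto)
qed

section \<open>Total imperfectness\<close>

lemma totally_imperfect_of_generic:
  fixes X :: "(cantor \<times> cantor) set"
  assumes misses: "\<And>x K. closed K \<Longrightarrow> K \<notin> null_sets cantor_measure \<Longrightarrow> \<exists>v\<in>K. (x, v) \<notin> X"
    and few: "\<And>W. (\<And>n. open (W n)) \<Longrightarrow> (\<And>x. Pair x -` frequently_outside W \<in> null_sets cantor_measure) \<Longrightarrow>
      |X \<inter> frequently_outside W| <o |UNIV :: cantor set|"
  shows "totally_imperfect X"
  unfolding totally_imperfect_def
proof
  assume "\<exists>P\<subseteq>X. P homeomorphic (UNIV :: cantor set)"
  then obtain P where P: "P \<subseteq> X" "P homeomorphic (UNIV :: cantor set)" by blast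
  then have "compact P" using compact_UNIV_cantor homeomorphic_compactness by blast
  then have cl: "closed P" by (rule closed_if_compact_cantor_prod)
  \<comment> \<open>A closed set is the \<open>limsup\<close> of the constant sequence, so the
    smallness hypothesis applies to \<open>P\<close> itself.\<close>
  have fo: "frequently_outside (\<lambda>n::nat. - P) = P"
    by (auto simp: frequently_outside_def)
  have "Pair x -` P \<in> null_sets cantor_measure" for x
  proof (rule ccontr)
    assume "\<not> ?thesis"
    moreover have "closed (Pair x -` P)" using cl by (intro closed_vimage continuous_intros) auto
    ultimately obtain v where "v \<in> Pair x -` P" "(x, v) \<notin> X" using misses by blast
    then show False using P(1) by auto
  qed
  then have "|X \<inter> P| <o |UNIV :: cantor set|"
    using few[of "\<lambda>_. - P"] cl by (simp add: fo open_Compl)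
  moreover have "X \<inter> P = P" using P(1) by auto
  moreover have "|P| =o |UNIV :: cantor set|"
  proof -
    obtain f g where "homeomorphism P (UNIV :: cantor set) f g" using P(2) by (auto simp: homeomorphic_def)
    then have "bij_betw f P UNIV" by (intro bij_betw_byWitness[of _ g]) (auto simp: homeomorphism_def)
    then show ?thesis using card_of_ordIso by blast
  qed
  ultimately show False using not_ordLess_ordIso by fastforce
qed

section \<open>Failure of the selection principle\<close>

text \<open>A binary sequence is read as an infinite matrix through
  \<open>prod_encode\<close>.\<close>

definition first_in_row :: "nat \<Rightarrow> nat \<Rightarrow> cantor set" where
  "first_in_row n k = {x. x (prod_encode (n, k)) \<and> (\<forall>j<k. \<not> x (prod_encode (n, j)))}"

lemma closed_first_in_row: "closed (first_in_row n k)"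
proof -
  obtain m where m: "\<And>j. j \<le> k \<Longrightarrow> prod_encode (n, j) < m"
    using finite_nat_iff_bounded[of "(\<lambda>j. prod_encode (n, j)) ` {..k}"] by auto
  show ?thesis
  proof (rule closed_if_saturated[where n=m], rule subsetI)
    fix x y assume "x \<in> first_in_row n k" "y \<in> cyl m x"
    then show "y \<in> first_in_row n k" using m by (auto simp: first_in_row_def cyl_def)
  qed
qed

text \<open>For fixed \<open>n\<close> the sets \<open>first_in_row n k\<close> are disjoint, so their complements form a
  gamma-cover, while \<open>(\<Inter>n. first_in_row n (f n)) \<noteq> {}\<close> for every \<open>f\<close>. A set that projects onto the
  Cantor space therefore admits no selection.\<close>

lemma not_S1_Gamma_O_of_full_projection:
  fixes X :: "(cantor \<times> 'a::topological_space) set"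
  assumes proj: "fst ` X = UNIV"
  shows "\<not> S1_Gamma_O X"
proof
  assume S1: "S1_Gamma_O X"
  define V :: "nat \<Rightarrow> nat \<Rightarrow> (cantor \<times> 'a) set" where "V n k = (- first_in_row n k) \<times> UNIV" for n k
  have op: "open (V n k)" for n k
    unfolding V_def by (intro open_Times open_Compl closed_first_in_row open_UNIV)
  have "gamma_cover (V n) X" for n
    unfolding gamma_cover_def
  proof
    fix p assume "p \<in> X"
    \<comment> \<open>A row has at most one first true entry, so a point misses at most one of the
      sets \<open>V n k\<close>.\<close>
    have "i = j" if "i \<in> - {k. p \<in> V n k}" "j \<in> - {k. p \<in> V n k}" for i j
      using that by (cases p) (auto simp: V_def first_in_row_def, metis linorder_neqE_nat)
    then show "finite (- {k. p \<in> V n k})" by (metis finite.simps is_singletonI' is_singleton_def)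
  qed
  then have "\<forall>n. range (V n) \<in> open_gamma_covers X"
    using op by (auto simp: open_gamma_covers_def)
  with S1[unfolded S1_Gamma_O_def, rule_format, of "\<lambda>n. range (V n)"]
  obtain U where U: "\<And>n. U n \<in> range (V n)" "X \<subseteq> (\<Union>n. U n)"
    by auto
  from U(1) have "\<forall>n. \<exists>k. U n = V n k" by (simp add: image_iff)
  then obtain f where f: "\<And>n. U n = V n (f n)" by metis
  \<comment> \<open>The matrix whose row \<open>n\<close> has its only true entry at
    \<open>f n\<close> lies in every \<open>first_in_row n (f n)\<close>, so no selected set
    contains a point above it.\<close>
  define x :: cantor where "x i = (case prod_decode i of (n, k) \<Rightarrow> k = f n)" for i
  have "x \<in> fst ` X" using proj by simp
  then obtain v where "(x, v) \<in> X" by auto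
  then obtain n where "(x, v) \<in> V n (f n)" using U(2) f by auto
  then show False by (auto simp: V_def first_in_row_def x_def)
qed

theorem corollary2p11:
  assumes "cov_null =o bounding_number" and "bounding_number =o continuum"
  shows "(\<exists>X :: cantor set. hurewicz X \<and> totally_imperfect X \<and> \<not> S1_Gamma_O X) \<or>
         (\<exists>X :: (cantor \<times> cantor) set. hurewicz X \<and> totally_imperfect X \<and> \<not> S1_Gamma_O X)"
proof -
  have "cov_null =o continuum" using assms by (rule ordIso_transitive)
  from ex_generic_points[OF this] obtain x y :: "cantor \<Rightarrow> cantor" and b :: "cantor \<Rightarrow> bool"
    where y: "inj y"
    and meets: "\<forall>x' K b'. closed K \<longrightarrow> K \<notin> null_sets cantor_measure \<longrightarrow>
      (\<exists>a. x a = x' \<and> y a \<in> K \<and> b a = b')"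
    and few: "\<forall>W. (\<forall>n. open (W n)) \<longrightarrow>
      (\<forall>x'. Pair x' -` frequently_outside W \<in> null_sets cantor_measure) \<longrightarrow>
      |{a. (x a, y a) \<in> frequently_outside W}| <o |UNIV :: cantor set|"
    by (elim exE conjE)
  \<comment> \<open>Only the points labelled \<open>True\<close> are kept; those labelled
    \<open>False\<close> show that the complement meets every closed nonnull set on each
    line.\<close>
  define X where "X = {(x a, y a) |a. b a}"
  have fewX: "|X \<inter> frequently_outside W| <o |UNIV :: cantor set|"
    if "\<And>n. open (W n)" "\<And>x'. Pair x' -` frequently_outside W \<in> null_sets cantor_measure" for W
  proof -
    have "X \<inter> frequently_outside W \<subseteq> (\<lambda>a. (x a, y a)) ` {a. (x a, y a) \<in> frequently_outside W}"
      by (auto simp: X_def)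
    then show ?thesis
      by (rule ordLeq_ordLess_trans[OF surj_imp_ordLeq few[rule_format, OF that]])
  qed
  have hit: "\<exists>v\<in>K. (x', v) \<in> X" if "closed K" "K \<notin> null_sets cantor_measure" for x' K
    using meets[rule_format, OF that, of x' True] by (auto simp: X_def)
  have miss: "\<exists>v\<in>K. (x', v) \<notin> X" if "closed K" "K \<notin> null_sets cantor_measure" for x' K
  proof -
    from meets[rule_format, OF that, of x' False] obtain a where a: "y a \<in> K" "\<not> b a" by auto
    \<comment> \<open>Since \<open>y\<close> is injective, the value \<open>y a\<close> belongs to
      the single index \<open>a\<close>, whose label is \<open>False\<close>.\<close>
    then have "(x', y a) \<notin> X" using y by (auto simp: X_def inj_def)
    then show ?thesis using a by blast
  qed
  have "x' \<in> fst ` X" for x'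
    using hit[OF closed_UNIV UNIV_not_null, of x'] by (auto intro: rev_image_eqI)
  then have "\<not> S1_Gamma_O X" by (intro not_S1_Gamma_O_of_full_projection) auto
  moreover have "hurewicz X" by (rule hurewicz_of_generic[OF assms(2) hit fewX])
  moreover have "totally_imperfect X" by (rule totally_imperfect_of_generic[OF miss fewX])
  ultimately show ?thesis by blast
qed

end
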